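(* Let $(V_1,V_2)$, the constant $A$, the operator $L_\omega$ and the weighted norm $\|\cdot\|_{C^0_\theta((-R,R))}$ be as in the context. Given $\theta\in(0,1)$, for large $R$ and $\omega=R^{-\theta}$ let the pair $(\varphi_1,\varphi_2)$ (depending on $R$) be defined on $[-R,R]$ by $$\varphi_1(x)=\big(V_1'(x)-A\big)\eta_R(x)+A\,\frac{\sinh(\omega(R-x))}{\sinh(\omega R)},\qquad \varphi_2(x)=V_2'(x)\,\eta_R(x),\qquad x\in[0,R],$$ and $$(\varphi_1(x),\varphi_2(x))=(-\varphi_2(-x),-\varphi_1(-x)),\qquad x\in[-R,0],$$ where $\eta_R(x)=\zeta(|x|/\ln R)$ and $\zeta$ is a smooth cutoff function with $\zeta(y)=1$ if $|y|<\tfrac12$ and $\zeta(y)=0$ if $|y|>\tfrac34$. Then $(\varphi_1,\varphi_2)$ satisfies $$\limsup_{R\to\infty}\ \omega^{-1}\,\|L_\omega(\varphi_1,\varphi_2)\|_{C^0_\theta((-R,R))}<\infty\qquad\text{with }\omega=R^{-\theta},$$ while $$(\varphi_1,\varphi_2)\to(V_1',V_2')\quad\text{in }C_{loc}(\mathbb{R})\ \text{ as }R\to\infty.$$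
   Context: The pair $(V_1,V_2)$, with $V_1,V_2>0$, denotes the solution (whose existence and uniqueness are known) of $$-V_1''+V_1V_2^2=0,\qquad -V_2''+V_2V_1^2=0\quad\text{in }\mathbb{R},$$ with $V_1(0)=V_2(0)=1$, $V_1(-x)=V_2(x)$ and $V_1'(x)>0$ for $x\in\mathbb{R}$, and with $$V_1(x)=Ax+B+\mathcal{O}(e^{-cx^2})\ \text{ as }x\to+\infty,\qquad V_1(x)=\mathcal{O}(e^{-cx^2})\ \text{ as }x\to-\infty,$$ for some constants $A>0$, $B\in\mathbb{R}$ and $c>0$. For $\omega\ge 0$, the linear operator $L_\omega$ acts on pairs $\varphi=(\varphi_1,\varphi_2)$ of functions of one variable $x$ by $$L_\omega\varphi=\begin{pmatrix}-\varphi_1''+V_2^2\varphi_1+2V_1V_2\varphi_2+\omega^2\varphi_1\\ -\varphi_2''+V_1^2\varphi_2+2V_1V_2\varphi_1+\omega^2\varphi_2\end{pmatrix}.$$ For a pair of functions $g=(g_1,g_2)$ on $(-R,R)$ the weighted norm is $$\|g\|_{C^0_\theta((-R,R))}=\|g\cosh(\theta x)\|_{C^0((-R,R))},$$ where $\|\cdot\|_{C^0}$ is the supremum norm. Convergence in $C_{loc}(\mathbb{R})$ means uniform convergence on every compact subset of $\mathbb{R}$.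
   Formalization: The supremum norm of L_ω(φ_1,φ_2) is taken over (-R,R) without the point x=0, because both components have a corner there (φ_1' jumps by -Aω coth(ωR)), so L_ω(φ_1,φ_2) is undefined at 0; twice differentiability on (-R,R) minus {0} is proved for large R. *)

theory Defs
  imports "HOL-Analysis.Analysis" "HOL-Library.Landau_Symbols"
begin

(* Being twice differentiable is demanded explicitly, because deriv takes unspecified values
   where the derivative does not exist. *)
definition twice_differentiable_on :: "(real \<Rightarrow> real) \<Rightarrow> real set \<Rightarrow> bool" where
  "twice_differentiable_on f S \<longleftrightarrow>
     (\<forall>x\<in>S. f differentiable (at x) \<and> deriv f differentiable (at x))"

(* A is the slope of V1 at +infinity; it is determined by V1, whereas B and c play no role
   in what follows and are hidden. *)
definition profile :: "(real \<Rightarrow> real) \<Rightarrow> (real \<Rightarrow> real) \<Rightarrow> real \<Rightarrow> bool" where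
  "profile V1 V2 A \<longleftrightarrow>
     (\<forall>x. V1 x > 0 \<and> V2 x > 0) \<and>
     twice_differentiable_on V1 UNIV \<and> twice_differentiable_on V2 UNIV \<and>
     (\<forall>x. - deriv (deriv V1) x + V1 x * (V2 x)\<^sup>2 = 0) \<and>
     (\<forall>x. - deriv (deriv V2) x + V2 x * (V1 x)\<^sup>2 = 0) \<and>
     V1 0 = 1 \<and> V2 0 = 1 \<and>
     (\<forall>x. V1 (- x) = V2 x) \<and>
     (\<forall>x. deriv V1 x > 0) \<and>
     A > 0 \<and>
     (\<exists>B c. c > 0 \<and>
        (\<lambda>x. V1 x - (A * x + B)) \<in> O[at_top](\<lambda>x. exp (- c * x\<^sup>2)) \<and>
        V1 \<in> O[at_bot](\<lambda>x. exp (- c * x\<^sup>2)))"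

definition L_op ::
  "(real \<Rightarrow> real) \<Rightarrow> (real \<Rightarrow> real) \<Rightarrow> real \<Rightarrow>
   (real \<Rightarrow> real) \<times> (real \<Rightarrow> real) \<Rightarrow> (real \<Rightarrow> real) \<times> (real \<Rightarrow> real)" where
  "L_op V1 V2 \<omega> \<phi> =
     ((\<lambda>x. - deriv (deriv (fst \<phi>)) x + (V2 x)\<^sup>2 * fst \<phi> x
            + 2 * V1 x * V2 x * snd \<phi> x + \<omega>\<^sup>2 * fst \<phi> x),
      (\<lambda>x. - deriv (deriv (snd \<phi>)) x + (V1 x)\<^sup>2 * snd \<phi> x
            + 2 * V1 x * V2 x * fst \<phi> x + \<omega>\<^sup>2 * snd \<phi> x))"

(* Extended-real valued, so that an unbounded pair has norm infinity. *)
definition weighted_norm ::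
  "real \<Rightarrow> real set \<Rightarrow> (real \<Rightarrow> real) \<times> (real \<Rightarrow> real) \<Rightarrow> ereal" where
  "weighted_norm \<theta> S g =
     (SUP x\<in>S. ereal (norm (fst g x * cosh (\<theta> * x), snd g x * cosh (\<theta> * x))))"

definition smooth_cutoff :: "(real \<Rightarrow> real) \<Rightarrow> bool" where
  "smooth_cutoff \<zeta> \<longleftrightarrow>
     (\<forall>n x. (deriv ^^ n) \<zeta> differentiable (at x)) \<and>
     (\<forall>y. \<bar>y\<bar> < 1/2 \<longrightarrow> \<zeta> y = 1) \<and>
     (\<forall>y. \<bar>y\<bar> > 3/4 \<longrightarrow> \<zeta> y = 0)"

definition cutoff_at :: "(real \<Rightarrow> real) \<Rightarrow> real \<Rightarrow> real \<Rightarrow> real" where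
  "cutoff_at \<zeta> R x = \<zeta> (\<bar>x\<bar> / ln R)"

definition right1 ::
  "(real \<Rightarrow> real) \<Rightarrow> real \<Rightarrow> (real \<Rightarrow> real) \<Rightarrow> real \<Rightarrow> real \<Rightarrow> real \<Rightarrow> real" where
  "right1 V1 A \<zeta> \<omega> R x =
     (deriv V1 x - A) * cutoff_at \<zeta> R x + A * (sinh (\<omega> * (R - x)) / sinh (\<omega> * R))"

definition right2 ::
  "(real \<Rightarrow> real) \<Rightarrow> (real \<Rightarrow> real) \<Rightarrow> real \<Rightarrow> real \<Rightarrow> real" where
  "right2 V2 \<zeta> R x = deriv V2 x * cutoff_at \<zeta> R x"

(* The pair is of interest on [-R,R] only; outside, the same formulas are kept.
   At x = 0 the two branches agree, since deriv V1 0 = - deriv V2 0 for a profile,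
   but their derivatives differ there: both components have a corner at 0. *)
definition phi ::
  "(real \<Rightarrow> real) \<Rightarrow> (real \<Rightarrow> real) \<Rightarrow> real \<Rightarrow> (real \<Rightarrow> real) \<Rightarrow> real \<Rightarrow> real \<Rightarrow>
   (real \<Rightarrow> real) \<times> (real \<Rightarrow> real)" where
  "phi V1 V2 A \<zeta> \<omega> R =
     ((\<lambda>x. if 0 \<le> x then right1 V1 A \<zeta> \<omega> R x else - right2 V2 \<zeta> R (- x)),
      (\<lambda>x. if 0 \<le> x then right2 V2 \<zeta> R x else - right1 V1 A \<zeta> \<omega> R (- x)))"

end

theory Submission
  imports Defs
begin

text \<open>Since \<open>(V\<^sub>1', V\<^sub>2')\<close> lies in the kernel of \<open>L\<^sub>0\<close> and \<open>s(x) = sinh(\<omega>(R - x)) / sinh(\<omega>R)\<close> satisfies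
  \<open>s'' = \<omega>\<^sup>2 s\<close>, for \<open>x > 0\<close> everything cancels in \<open>L_\<omega> \<phi>\<close> except commutators with the cutoff \<open>\<eta>\<close>,
  the terms \<open>\<omega>\<^sup>2 (V\<^sub>1' - A) \<eta>\<close> and \<open>\<omega>\<^sup>2 V\<^sub>2' \<eta>\<close>, and the interaction terms carrying a factor \<open>s - \<eta>\<close>.
  All their coefficients decay faster than any exponential. The cutoff only acts where
  \<open>x \<ge> ln R / 2\<close>, so it costs \<open>O(1/R) = O(\<omega>)\<close>, and \<open>\<bar>s - 1\<bar> \<le> 2 \<omega> x\<close>, which is where the rate \<open>\<omega>\<close>
  comes from. The half-line \<open>x < 0\<close> follows by the symmetry \<open>V\<^sub>1(-x) = V\<^sub>2(x)\<close>.\<close>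

section \<open>Calculus on open half-lines and under odd reflection\<close>

text \<open>Differentiability is local, so agreement with a smooth formula \<open>f0\<close> on an
  open set transfers two derivatives. This serves the piecewise pair \<open>phi\<close>, which is
  given by a smooth formula on each open half-line and has a corner at 0.\<close>

lemma second_derivative_on_open:
  fixes f f0 f1 f2 :: "real \<Rightarrow> real"
  assumes S: "open S" "x \<in> S"
    and f: "\<And>y. y \<in> S \<Longrightarrow> f y = f0 y"
    and f0: "\<And>y. y \<in> S \<Longrightarrow> (f0 has_real_derivative f1 y) (at y)"
    and f1: "\<And>y. y \<in> S \<Longrightarrow> (f1 has_real_derivative f2 y) (at y)"
  shows "f differentiable (at x)" "deriv f differentiable (at x)" "deriv (deriv f) x = f2 x"
proof -
  have f': "(f has_real_derivative f1 y) (at y)" if "y \<in> S" for y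
    by (rule has_field_derivative_transform_within_open[OF f0[OF that] S(1) that])
      (simp add: f)
  have f'': "(deriv f has_real_derivative f2 x) (at x)"
    by (rule has_field_derivative_transform_within_open[OF f1[OF S(2)] S])
      (simp add: DERIV_imp_deriv[OF f'])
  show "f differentiable (at x)" "deriv f differentiable (at x)" "deriv (deriv f) x = f2 x"
    using f'[OF S(2)] f'' by (auto simp: real_differentiable_def intro: DERIV_imp_deriv)
qed

text \<open>Serves the left half-line, where \<open>phi\<close> is an odd reflection. The outer and
  the inner sign cancel in the first derivative; the second differentiation brings one sign
  back.\<close>

lemma odd_reflection_derivs:
  fixes f f' f'' :: "real \<Rightarrow> real"
  assumes "\<And>x. (f has_real_derivative f' x) (at x)" "\<And>x. (f' has_real_derivative f'' x) (at x)"
  shows "((\<lambda>x. - f (- x)) has_real_derivative f' (- x)) (at x)"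
    "((\<lambda>x. f' (- x)) has_real_derivative - f'' (- x)) (at x)"
proof -
  have "((\<lambda>x. f (- x)) has_real_derivative - f' (- x)) (at x)"
    using assms(1)[of "- x"] by (simp add: DERIV_mirror)
  from DERIV_minus[OF this] show "((\<lambda>x. - f (- x)) has_real_derivative f' (- x)) (at x)" by simp
  show "((\<lambda>x. f' (- x)) has_real_derivative - f'' (- x)) (at x)"
    using assms(2)[of "- x"] by (simp add: DERIV_mirror)
qed

section \<open>Elementary estimates: the sinh ratio, Gaussian decay, the residual\<close>

text \<open>By the mean value theorem the numerator differs from the denominator by at most
  \<open>\<omega> * x * cosh (\<omega> * R)\<close>, and cosh is at most twice sinh at arguments
  \<ge> 1, which is where \<open>\<omega> * R \<ge> 1\<close> enters.\<close>

lemma sinh_ratio_bound: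
  fixes \<omega> R x :: real
  assumes "\<omega> > 0" "\<omega> * R \<ge> 1" "0 \<le> x" "x \<le> R"
  shows "\<bar>sinh (\<omega> * (R - x)) / sinh (\<omega> * R) - 1\<bar> \<le> 2 * \<omega> * x"
proof (cases "x = 0")
  case True
  have "sinh (\<omega> * R) > 0" using assms by simp
  then have "sinh (\<omega> * R) \<noteq> 0" by (rule less_imp_neq[symmetric])
  then show ?thesis using True by (simp del: sinh_real_zero_iff)
next
  case False
  define u where "u = \<omega> * R"
  define v where "v = \<omega> * (R - x)"
  have v: "0 \<le> v" "v < u" and uv: "u - v = \<omega> * x"
    using assms False by (auto simp: u_def v_def algebra_simps)
  have u: "u \<ge> 1" using assms by (simp add: u_def)
  have pos: "sinh u > 0" using u by simp
  obtain z where z: "v < z" "z < u" "sinh u - sinh v = (u - v) * cosh z"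
    using MVT2[OF v(2), of sinh cosh] has_field_derivative_sinh[OF DERIV_ident]
    by (auto simp: mult.commute)
  have "cosh z \<le> cosh u" using z v by (simp add: cosh_real_nonneg_le_iff)
  \<comment> \<open>Written with exponentials, the claim is
    \<open>3 * exp (- u) \<le> exp u\<close>.\<close>
  also have "cosh u \<le> 2 * sinh u"
  proof -
    have "3 \<le> exp (2 * u)" using exp_ge_add_one_self[of "2 * u"] u by linarith
    then have "3 * exp (- u) \<le> exp (2 * u) * exp (- u)" by simp
    also have "\<dots> = exp u" by (simp flip: exp_add)
    finally show ?thesis by (simp add: cosh_def sinh_def)
  qed
  finally have "(u - v) * cosh z \<le> (u - v) * (2 * sinh u)"
    using v by (intro mult_left_mono) auto
  also have "\<dots> = 2 * \<omega> * x * sinh u" by (simp add: uv)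
  finally have "(sinh u - sinh v) / sinh u \<le> 2 * \<omega> * x"
    using z(3) pos by (simp only: pos_divide_le_eq)
  moreover have "sinh v / sinh u \<le> 1" using v pos by simp
  moreover have "(sinh u - sinh v) / sinh u = 1 - sinh v / sinh u"
    using pos by (simp add: diff_divide_distrib less_imp_neq[symmetric] del: sinh_real_zero_iff)
  ultimately have "\<bar>sinh v / sinh u - 1\<bar> \<le> 2 * \<omega> * x" by linarith
  then show ?thesis by (simp add: u_def v_def)
qed

text \<open>The Landau bound controls \<open>f\<close> only near infinity; on the remaining compact
  interval continuity bounds \<open>f x * exp (k * x)\<close>. The rate \<open>k\<close> is free
  because a Gaussian beats every exponential.\<close>

lemma gaussian_bigo_imp_exp_bound:
  fixes f :: "real \<Rightarrow> real"
  assumes cont: "continuous_on UNIV f" and c: "c > 0"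
    and f: "f \<in> O[at_top](\<lambda>x. exp (- c * x\<^sup>2))"
  shows "\<exists>C\<ge>0. \<forall>x\<ge>0. \<bar>f x\<bar> \<le> C * exp (- k * x)"
proof -
  obtain a where "a > 0" and ev: "eventually (\<lambda>x. norm (f x) \<le> a * norm (exp (- c * x\<^sup>2))) at_top"
    using f by (elim landau_o.bigE)
  then obtain N where N: "\<And>x. x \<ge> N \<Longrightarrow> \<bar>f x\<bar> \<le> a * exp (- c * x\<^sup>2)"
    by (auto simp: eventually_at_top_linorder)
  \<comment> \<open>Beyond \<open>N\<close> the Landau estimate holds, and beyond
    \<open>k / c\<close> one has \<open>k * x \<le> c * x\<^sup>2\<close>.\<close>
  define M where "M = max N (max 0 (k / c))"
  have "bounded ((\<lambda>x. f x * exp (k * x)) ` {0..M})"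
    by (intro compact_imp_bounded compact_continuous_image continuous_intros
        continuous_on_subset[OF cont]) auto
  then obtain b where b: "\<And>x. x \<in> {0..M} \<Longrightarrow> \<bar>f x * exp (k * x)\<bar> \<le> b"
    unfolding bounded_iff by fastforce
  have "\<bar>f x\<bar> \<le> max a b * exp (- k * x)" if "x \<ge> 0" for x
  proof (cases "x \<le> M")
    case True
    have "\<bar>f x\<bar> = \<bar>f x * exp (k * x)\<bar> * exp (- k * x)"
      by (simp add: abs_mult mult.assoc flip: exp_add)
    also have "\<dots> \<le> max a b * exp (- k * x)"
      using b[of x] that True by (intro mult_right_mono) auto
    finally show ?thesis .
  next
    case False
    then have "k / c \<le> x" "N \<le> x" "0 \<le> x" by (auto simp: M_def)
    then have "k \<le> c * x" using c by (simp add: field_simps)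
    then have "k * x \<le> c * x * x" using \<open>0 \<le> x\<close> by (rule mult_right_mono)
    then have "exp (- c * x\<^sup>2) \<le> exp (- k * x)" by (simp add: power2_eq_square mult.assoc)
    then have "a * exp (- c * x\<^sup>2) \<le> max a b * exp (- k * x)"
      using \<open>a > 0\<close> by (intro mult_mono) auto
    then show ?thesis using N[OF \<open>N \<le> x\<close>] by linarith
  qed
  then show ?thesis using \<open>a > 0\<close> by (intro exI[of _ "max a b"]) auto
qed

text \<open>Both components of \<open>L_\<omega> \<phi>\<close> on the right half-line have the following shape, with
  \<open>(a, b, c) = (V\<^sub>1'', V\<^sub>1' - A, V\<^sub>2\<^sup>2)\<close> and \<open>(V\<^sub>2'', V\<^sub>2', 2 V\<^sub>1 V\<^sub>2)\<close> respectively. The terms with a factor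
  \<open>h1\<close>, \<open>h2\<close> or \<open>1 - h\<close> live where \<open>x \<ge> ln R / 2\<close>, so that \<open>exp (- 2 * x) \<le> 1 / R\<close> there.\<close>

lemma residual_bound:
  fixes a b c h h1 h2 s x R \<omega> A K M :: real
  assumes x: "0 \<le> x" and R: "R > 0" and \<omega>: "1 / R \<le> \<omega>" "\<omega> \<le> 1"
    and abc: "\<bar>a\<bar> \<le> K * exp (- 4 * x)" "\<bar>b\<bar> \<le> K * exp (- 4 * x)" "\<bar>c\<bar> \<le> K * exp (- 4 * x)"
    and h: "\<bar>h\<bar> \<le> M" "\<bar>h1\<bar> \<le> M" "\<bar>h2\<bar> \<le> M"
    and h0: "x < ln R / 2 \<Longrightarrow> h = 1 \<and> h1 = 0 \<and> h2 = 0"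
    and s: "\<bar>s - 1\<bar> \<le> 2 * \<omega> * x"
  shows "\<bar>- 2 * a * h1 - b * h2 + c * A * (s - h) + \<omega>\<^sup>2 * b * h\<bar> * exp x
           \<le> K * (4 * M + \<bar>A\<bar> * (M + 3)) * \<omega>"
proof -
  \<comment> \<open>What remains of the coefficient decay \<open>exp (- 4 * x)\<close> after paying
    for the weight \<open>exp x\<close>.\<close>
  define E where "E = exp (- 3 * x)"
  have E: "0 < E" "E \<le> 1" using x by (auto simp: E_def)
  have K: "K \<ge> 0"
    using abc(1) by (smt (verit) exp_gt_zero zero_le_mult_iff)
  have M: "M \<ge> 0" using h by linarith
  have \<omega>0: "0 < \<omega>" using \<omega> R by (smt (verit) divide_pos_pos)
  have abc': "\<bar>t\<bar> * exp x \<le> K * E" if "\<bar>t\<bar> \<le> K * exp (- 4 * x)" for t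
  proof -
    have "\<bar>t\<bar> * exp x \<le> K * exp (- 4 * x) * exp x" using that by simp
    also have "\<dots> = K * E" by (simp add: E_def mult.assoc flip: exp_add)
    finally show ?thesis .
  qed
  have small: "E * \<bar>t\<bar> \<le> m * \<omega>" if "\<bar>t\<bar> \<le> m" "x < ln R / 2 \<Longrightarrow> t = 0" for t m
  proof (cases "x < ln R / 2")
    case True
    then show ?thesis using that \<omega>0 by auto
  next
    case False
    then have "E \<le> exp (- ln R)" using x by (simp add: E_def)
    also have "\<dots> = 1 / R" using R by (simp add: exp_minus inverse_eq_divide)
    finally have "E \<le> \<omega>" using \<omega> by simp
    then have "E * \<bar>t\<bar> \<le> \<omega> * m" using that(1) E \<omega>0 by (intro mult_mono) auto
    then show ?thesis by (simp add: mult.commute)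
  qed
  have "\<bar>1 - h\<bar> \<le> M + 1" using h by linarith
  then have h': "E * \<bar>1 - h\<bar> \<le> (M + 1) * \<omega>" using h0 by (intro small) auto
  \<comment> \<open>The bound on \<open>s - 1\<close> grows linearly in \<open>x\<close>; the decay
    absorbs this through \<open>x * exp (- 3 * x) \<le> 1\<close>.\<close>
  have s': "E * \<bar>s - 1\<bar> \<le> 2 * \<omega>"
  proof -
    have "x \<le> exp x" using exp_ge_add_one_self[of x] by linarith
    also have "\<dots> \<le> exp (3 * x)" using x by simp
    finally have "E * x \<le> 1" by (simp add: E_def exp_minus field_simps)
    then have "\<omega> * (E * x) \<le> \<omega> * 1" using \<omega>0 by (intro mult_left_mono) auto
    moreover have "E * \<bar>s - 1\<bar> \<le> E * (2 * \<omega> * x)" using s E by (intro mult_left_mono) auto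
    ultimately show ?thesis by (simp add: algebra_simps)
  qed
  have prod: "\<bar>t * r\<bar> * exp x \<le> K * m" if "\<bar>t\<bar> \<le> K * exp (- 4 * x)" "E * \<bar>r\<bar> \<le> m" for t r m
  proof -
    have "\<bar>t * r\<bar> * exp x = (\<bar>t\<bar> * exp x) * \<bar>r\<bar>" by (simp add: abs_mult)
    also have "\<dots> \<le> (K * E) * \<bar>r\<bar>" using abc'[OF that(1)] by (intro mult_right_mono) auto
    also have "\<dots> \<le> K * m" using mult_left_mono[OF that(2) K] by (simp add: mult.assoc)
    finally show ?thesis .
  qed
  have 1: "\<bar>a * h1\<bar> * exp x \<le> K * (M * \<omega>)" using abc h h0 by (intro prod small) auto
  have 2: "\<bar>b * h2\<bar> * exp x \<le> K * (M * \<omega>)" using abc h h0 by (intro prod small) auto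
  \<comment> \<open>Split \<open>s - h\<close> at 1: \<open>s - 1\<close> contributes 2 and
    \<open>1 - h\<close> contributes \<open>M + 1\<close>.\<close>
  have 3: "\<bar>c * (s - h)\<bar> * exp x \<le> K * ((M + 3) * \<omega>)"
  proof (rule prod[OF abc(3)])
    have "E * \<bar>s - h\<bar> \<le> E * (\<bar>s - 1\<bar> + \<bar>1 - h\<bar>)" using E by (intro mult_left_mono) auto
    then show "E * \<bar>s - h\<bar> \<le> (M + 3) * \<omega>" using s' h' by (simp add: algebra_simps)
  qed
  have 4: "\<bar>b * (\<omega>\<^sup>2 * h)\<bar> * exp x \<le> K * (M * \<omega>)"
  proof (rule prod[OF abc(2)])
    have "\<omega>\<^sup>2 \<le> \<omega>" using \<omega> \<omega>0 by (simp add: power2_eq_square mult_left_le)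
    then have "\<omega>\<^sup>2 * \<bar>h\<bar> \<le> \<omega> * M" using h \<omega>0 by (intro mult_mono) auto
    then have "E * (\<omega>\<^sup>2 * \<bar>h\<bar>) \<le> 1 * (\<omega> * M)" by (rule mult_mono[rotated]) (use E in auto)
    then show "E * \<bar>\<omega>\<^sup>2 * h\<bar> \<le> M * \<omega>" by (simp add: abs_mult mult.commute)
  qed
  have "\<bar>- 2 * a * h1 - b * h2 + c * A * (s - h) + \<omega>\<^sup>2 * b * h\<bar> * exp x
      \<le> (2 * \<bar>a * h1\<bar> + \<bar>b * h2\<bar> + \<bar>A\<bar> * \<bar>c * (s - h)\<bar> + \<bar>b * (\<omega>\<^sup>2 * h)\<bar>) * exp x"
  proof (rule mult_right_mono)
    have "\<bar>A\<bar> * \<bar>c * (s - h)\<bar> = \<bar>c * A * (s - h)\<bar>" by (simp add: abs_mult)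
    moreover have "\<omega>\<^sup>2 * b * h = b * (\<omega>\<^sup>2 * h)" by simp
    ultimately show "\<bar>- 2 * a * h1 - b * h2 + c * A * (s - h) + \<omega>\<^sup>2 * b * h\<bar>
      \<le> 2 * \<bar>a * h1\<bar> + \<bar>b * h2\<bar> + \<bar>A\<bar> * \<bar>c * (s - h)\<bar> + \<bar>b * (\<omega>\<^sup>2 * h)\<bar>"
      by linarith
  qed simp
  also have "\<dots> = 2 * (\<bar>a * h1\<bar> * exp x) + \<bar>b * h2\<bar> * exp x + \<bar>A\<bar> * (\<bar>c * (s - h)\<bar> * exp x)
      + \<bar>b * (\<omega>\<^sup>2 * h)\<bar> * exp x"
    by (simp only: distrib_right mult.assoc)
  also have "\<dots> \<le> 2 * (K * (M * \<omega>)) + K * (M * \<omega>) + \<bar>A\<bar> * (K * ((M + 3) * \<omega>)) + K * (M * \<omega>)"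
    using 1 2 4 mult_left_mono[OF 3, of "\<bar>A\<bar>"] by linarith
  also have "\<dots> = K * (4 * M + \<bar>A\<bar> * (M + 3)) * \<omega>" by (simp add: algebra_simps)
  finally show ?thesis .
qed

section \<open>Derivatives and bounds of the cutoff function\<close>

lemma smooth_cutoff_deriv:
  assumes "smooth_cutoff \<zeta>"
  shows "(\<zeta> has_real_derivative deriv \<zeta> y) (at y)"
    and "(deriv \<zeta> has_real_derivative deriv (deriv \<zeta>) y) (at y)"
proof -
  have *: "(deriv ^^ n) \<zeta> differentiable (at y)" for n
    using assms by (auto simp: smooth_cutoff_def)
  show "(\<zeta> has_real_derivative deriv \<zeta> y) (at y)"
    using *[of 0] by (simp add: DERIV_deriv_iff_real_differentiable)
  show "(deriv \<zeta> has_real_derivative deriv (deriv \<zeta>) y) (at y)"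
    using *[of 1] by (simp add: DERIV_deriv_iff_real_differentiable)
qed

lemma deriv_zero_on_open:
  fixes f :: "real \<Rightarrow> real"
  assumes "open S" "\<And>y. y \<in> S \<Longrightarrow> f y = k" "y \<in> S"
  shows "deriv f y = 0"
proof -
  have "(f has_real_derivative 0) (at y)"
    by (rule has_field_derivative_transform_within_open[OF _ assms(1,3), of "\<lambda>_. k"])
      (use assms in auto)
  then show ?thesis by (rule DERIV_imp_deriv)
qed

lemma smooth_cutoff_near_zero:
  assumes "smooth_cutoff \<zeta>" "\<bar>y\<bar> < 1/2"
  shows "\<zeta> y = 1" "deriv \<zeta> y = 0" "deriv (deriv \<zeta>) y = 0"
proof -
  have 0: "\<zeta> y = 1" if "y \<in> {-1/2<..<1/2}" for y
    using assms(1) that by (auto simp: smooth_cutoff_def)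
  have 1: "deriv \<zeta> y = 0" if "y \<in> {-1/2<..<1/2}" for y
    using deriv_zero_on_open[OF _ 0 that] by simp
  have 2: "deriv (deriv \<zeta>) y = 0" if "y \<in> {-1/2<..<1/2}" for y
    using deriv_zero_on_open[OF _ 1 that] by simp
  have "y \<in> {-1/2<..<1/2}" using assms(2) by auto
  then show "\<zeta> y = 1" "deriv \<zeta> y = 0" "deriv (deriv \<zeta>) y = 0" using 0 1 2 by auto
qed

text \<open>The cutoff vanishes on the open complement of \<open>{-3/4..3/4}\<close>, hence so do
  its derivatives; on the compact interval itself all three functions are continuous.\<close>

lemma smooth_cutoff_bounded:
  assumes \<zeta>: "smooth_cutoff \<zeta>"
  obtains M where "\<And>y. \<bar>\<zeta> y\<bar> \<le> M" "\<And>y. \<bar>deriv \<zeta> y\<bar> \<le> M" "\<And>y. \<bar>deriv (deriv \<zeta>) y\<bar> \<le> M"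
proof -
  have 0: "\<zeta> y = 0" if "y \<in> - {-3/4..3/4}" for y
    using \<zeta> that by (auto simp: smooth_cutoff_def)
  have 1: "deriv \<zeta> y = 0" if "y \<in> - {-3/4..3/4}" for y
    using deriv_zero_on_open[OF _ 0 that] by (simp add: open_Compl)
  have 2: "deriv (deriv \<zeta>) y = 0" if "y \<in> - {-3/4..3/4}" for y
    using deriv_zero_on_open[OF _ 1 that] by (simp add: open_Compl)
  have bdd: "\<exists>b. \<forall>y. \<bar>f y\<bar> \<le> b"
    if f: "\<And>y. f differentiable (at y)" "\<And>y. y \<in> - {-3/4..3/4} \<Longrightarrow> f y = 0" for f :: "real \<Rightarrow> real"
  proof -
    have "continuous_on {-3/4..3/4} f"
      using f(1) by (meson continuous_at_imp_continuous_on differentiable_imp_continuous_within)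
    then have "bounded (f ` {-3/4..3/4})"
      by (intro compact_imp_bounded compact_continuous_image) auto
    then obtain b where b: "\<And>y. y \<in> {-3/4..3/4} \<Longrightarrow> \<bar>f y\<bar> \<le> b"
      unfolding bounded_iff by fastforce
    have "\<bar>f y\<bar> \<le> max 0 b" for y
      using b[of y] f(2)[of y] by (cases "y \<in> {-3/4..3/4}") auto
    then show ?thesis by blast
  qed
  have d: "(deriv ^^ n) \<zeta> differentiable (at y)" for n y
    using \<zeta> by (auto simp: smooth_cutoff_def)
  obtain b0 where b0: "\<And>y. \<bar>\<zeta> y\<bar> \<le> b0" using bdd[of \<zeta>] 0 d[of 0] by auto
  obtain b1 where b1: "\<And>y. \<bar>deriv \<zeta> y\<bar> \<le> b1" using bdd[of "deriv \<zeta>"] 1 d[of 1] by auto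
  obtain b2 where b2: "\<And>y. \<bar>deriv (deriv \<zeta>) y\<bar> \<le> b2"
    using bdd[of "deriv (deriv \<zeta>)"] 2 d[of 2] by (auto simp: numeral_2_eq_2)
  show thesis
    by (rule that[of "max b0 (max b1 b2)"]) (use b0 b1 b2 in \<open>auto simp: le_max_iff_disj\<close>)
qed

section \<open>The profile: derivatives, convexity and decay\<close>

locale profile_pair =
  fixes V1 V2 :: "real \<Rightarrow> real" and A :: real
  assumes profile: "profile V1 V2 A"
begin

lemma pos: "V1 x > 0" "V2 x > 0"
  using profile by (auto simp: profile_def)

lemma V1_minus: "V1 (- x) = V2 x" and V2_minus: "V2 (- x) = V1 x"
  using profile by (auto simp: profile_def) (metis minus_minus)

lemma V1_deriv: "(V1 has_real_derivative deriv V1 x) (at x)"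
  and V2_deriv: "(V2 has_real_derivative deriv V2 x) (at x)"
  using profile
  by (auto simp: profile_def twice_differentiable_on_def DERIV_deriv_iff_real_differentiable)

lemma V1_deriv2: "(deriv V1 has_real_derivative V1 x * (V2 x)\<^sup>2) (at x)"
proof -
  have "(deriv V1 has_real_derivative deriv (deriv V1) x) (at x)"
    using profile
    by (auto simp: profile_def twice_differentiable_on_def DERIV_deriv_iff_real_differentiable)
  moreover have "deriv (deriv V1) x = V1 x * (V2 x)\<^sup>2"
    using profile unfolding profile_def by (smt (verit))
  ultimately show ?thesis by simp
qed

lemma V2_deriv2: "(deriv V2 has_real_derivative V2 x * (V1 x)\<^sup>2) (at x)"
proof -
  have "(deriv V2 has_real_derivative deriv (deriv V2) x) (at x)"
    using profile
    by (auto simp: profile_def twice_differentiable_on_def DERIV_deriv_iff_real_differentiable)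
  moreover have "deriv (deriv V2) x = V2 x * (V1 x)\<^sup>2"
    using profile unfolding profile_def by (smt (verit))
  ultimately show ?thesis by simp
qed

lemma deriv_V2: "deriv V2 x = - deriv V1 (- x)"
proof -
  have "((\<lambda>x. V1 (- x)) has_real_derivative - deriv V1 (- x)) (at x)"
    using V1_deriv[of "- x"] by (simp add: DERIV_mirror)
  then show ?thesis by (simp add: V1_minus DERIV_imp_deriv)
qed

lemma V1_deriv_mono: "x \<le> y \<Longrightarrow> deriv V1 x \<le> deriv V1 y"
  by (erule DERIV_nonneg_imp_nondecreasing)
    (use V1_deriv2 pos in \<open>meson less_imp_le mult_nonneg_nonneg zero_le_power2\<close>)

text \<open>Convexity squeezes the derivative between difference quotients, which transfers the decay
  of \<open>V1\<close> to its derivative without integrating the equation.\<close>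

lemma V1_deriv_squeeze:
  "V1 x - V1 (x - 1) \<le> deriv V1 x" "deriv V1 x \<le> V1 (x + 1) - V1 x"
proof -
  obtain z where "x - 1 < z" "z < x" "V1 x - V1 (x - 1) = deriv V1 z"
    using MVT2[of "x - 1" x V1 "deriv V1"] V1_deriv by auto
  then show "V1 x - V1 (x - 1) \<le> deriv V1 x" using V1_deriv_mono[of z x] by simp
  obtain z where "x < z" "z < x + 1" "V1 (x + 1) - V1 x = deriv V1 z"
    using MVT2[of x "x + 1" V1 "deriv V1"] V1_deriv by auto
  then show "deriv V1 x \<le> V1 (x + 1) - V1 x" using V1_deriv_mono[of x z] by simp
qed

text \<open>Collects every coefficient that occurs in the residuals. Rate 6 for \<open>V2\<close>
  against the crude growth bound \<open>exp x\<close> for \<open>V1\<close> leaves rate 4 in the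
  worst product \<open>V2 x * (V1 x)\<^sup>2\<close>.\<close>

lemma exponential_decay:
  obtains K where
    "\<And>x. x \<ge> 0 \<Longrightarrow> \<bar>deriv V1 x - A\<bar> \<le> K * exp (- 4 * x)"
    "\<And>x. x \<ge> 0 \<Longrightarrow> \<bar>deriv V2 x\<bar> \<le> K * exp (- 4 * x)"
    "\<And>x. x \<ge> 0 \<Longrightarrow> \<bar>V1 x * (V2 x)\<^sup>2\<bar> \<le> K * exp (- 4 * x)"
    "\<And>x. x \<ge> 0 \<Longrightarrow> \<bar>V2 x * (V1 x)\<^sup>2\<bar> \<le> K * exp (- 4 * x)"
    "\<And>x. x \<ge> 0 \<Longrightarrow> \<bar>(V2 x)\<^sup>2\<bar> \<le> K * exp (- 4 * x)"
    "\<And>x. x \<ge> 0 \<Longrightarrow> \<bar>2 * V1 x * V2 x\<bar> \<le> K * exp (- 4 * x)"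
proof -
  obtain B c where c: "c > 0"
    and top: "(\<lambda>x. V1 x - (A * x + B)) \<in> O[at_top](\<lambda>x. exp (- c * x\<^sup>2))"
    and bot: "V1 \<in> O[at_bot](\<lambda>x. exp (- c * x\<^sup>2))"
    using profile by (auto simp: profile_def)
  have V2_top: "V2 \<in> O[at_top](\<lambda>x. exp (- c * x\<^sup>2))"
    using bot by (simp add: at_bot_mirror landau_o.big.in_filtermap_iff V1_minus)
  have cont1: "continuous_on UNIV V1" and cont2: "continuous_on UNIV V2"
    using V1_deriv V2_deriv by (meson DERIV_continuous_on has_field_derivative_at_within)+
  obtain C1 where C1: "C1 \<ge> 0" "\<And>x. x \<ge> 0 \<Longrightarrow> \<bar>V1 x - (A * x + B)\<bar> \<le> C1 * exp (- 6 * x)"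
    using gaussian_bigo_imp_exp_bound[OF _ c top, of 6] cont1
    by (force intro!: continuous_intros)
  obtain C2 where C2: "C2 \<ge> 0" "\<And>x. x \<ge> 0 \<Longrightarrow> \<bar>V2 x\<bar> \<le> C2 * exp (- 6 * x)"
    using gaussian_bigo_imp_exp_bound[OF cont2 c V2_top, of 6] by auto
  \<comment> \<open>One constant for the growth of \<open>V1\<close> and the decay of
    \<open>V2\<close>; the summand \<open>V1 1\<close> covers \<open>V2 (x - 1)\<close> for
    \<open>x\<close> in [0,1).\<close>
  define C where "C = C1 + C2 + \<bar>A\<bar> + \<bar>B\<bar> + V1 0 + V1 1"
  have C0: "C \<ge> 0" using C1(1) C2(1) pos[of 0] pos[of 1] by (simp add: C_def)
  have v2: "V2 x \<le> C * exp (- 6 * x)" if "x \<ge> 0" for x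
  proof -
    have "C2 * exp (- 6 * x) \<le> C * exp (- 6 * x)"
      using C1(1) pos[of 0] pos[of 1] by (intro mult_right_mono) (auto simp: C_def)
    then show ?thesis using C2(2)[OF that] by linarith
  qed
  have v1: "V1 x \<le> C * exp x" if "x \<ge> 0" for x
  proof -
    have "C1 * exp (- 6 * x) \<le> C1 * exp x" using C1(1) that by (intro mult_left_mono) auto
    moreover have "A * x \<le> \<bar>A\<bar> * exp x"
      using that order_trans[OF _ exp_ge_add_one_self[of x], of x] by (intro mult_mono) auto
    moreover have "\<bar>B\<bar> * 1 \<le> \<bar>B\<bar> * exp x" using that by (intro mult_left_mono) auto
    ultimately have "V1 x \<le> (C1 + \<bar>A\<bar> + \<bar>B\<bar>) * exp x"
      using C1(2)[OF that] by (simp add: algebra_simps)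
    also have "\<dots> \<le> C * exp x"
      using C2(1) pos[of 0] pos[of 1] by (intro mult_right_mono) (auto simp: C_def)
    finally show ?thesis .
  qed
  \<comment> \<open>Bounds \<open>deriv V1 x - A\<close> on [0,1] by monotonicity. There
    \<open>x - 1\<close> can leave the half-line on which the asymptotics were bounded.\<close>
  define D where "D = \<bar>deriv V1 1\<bar> + \<bar>deriv V1 0\<bar> + \<bar>A\<bar>"
  have shift: "exp (- 6 * (x - 1)) = exp 6 * exp (- 6 * x)" for x :: real
    by (simp flip: exp_add)
  have d1: "\<bar>deriv V1 x - A\<bar> \<le> (2 * C1 * exp 6 + D * exp 6) * exp (- 6 * x)" if "x \<ge> 0" for x
  proof (cases "x \<ge> 1")
    case True
    have e: "exp (- 6 * x) \<le> exp 6 * exp (- 6 * x)" "exp (- 6 * (x + 1)) \<le> exp 6 * exp (- 6 * x)"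
      by (simp_all flip: exp_add)
    have "C1 * exp (- 6 * x) \<le> C1 * (exp 6 * exp (- 6 * x))"
      "C1 * exp (- 6 * (x + 1)) \<le> C1 * (exp 6 * exp (- 6 * x))"
      using C1(1) e by (auto intro: mult_left_mono simp del: exp_le_cancel_iff)
    moreover have "\<bar>V1 (x - 1) - (A * (x - 1) + B)\<bar> \<le> C1 * (exp 6 * exp (- 6 * x))"
      using C1(2)[of "x - 1"] True by (simp only: shift)
    \<comment> \<open>The affine asymptote has difference quotient exactly \<open>A\<close>, so each
      side of the squeeze differs from \<open>A\<close> by two remainders. The factor
      \<open>exp 6\<close> pays for the unit shift.\<close>
    ultimately have "\<bar>deriv V1 x - A\<bar> \<le> 2 * (C1 * (exp 6 * exp (- 6 * x)))"
      using C1(2)[of x] C1(2)[of "x + 1"] True V1_deriv_squeeze[of x]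
      by (simp add: distrib_left right_diff_distrib abs_le_iff)
    moreover have "0 \<le> D * exp 6 * exp (- 6 * x)" by (simp add: D_def)
    ultimately show ?thesis by (simp add: algebra_simps)
  next
    case False
    have "\<bar>deriv V1 x - A\<bar> \<le> D"
      using V1_deriv_mono[of 0 x] V1_deriv_mono[of x 1] that False by (auto simp: D_def)
    also have "D * 1 \<le> D * (exp 6 * exp (- 6 * x))"
      using False by (intro mult_left_mono) (auto simp: D_def simp flip: exp_add)
    finally have "\<bar>deriv V1 x - A\<bar> \<le> D * exp 6 * exp (- 6 * x)" by simp
    moreover have "0 \<le> 2 * C1 * exp 6 * exp (- 6 * x)" using C1(1) by simp
    ultimately show ?thesis by (simp add: algebra_simps)
  qed
  have d2: "\<bar>deriv V2 x\<bar> \<le> C * exp 6 * exp (- 6 * x)" if "x \<ge> 0" for x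
  proof -
    have "deriv V1 (- x) > 0" using profile by (auto simp: profile_def)
    then have "\<bar>deriv V2 x\<bar> = deriv V1 (- x)" by (simp add: deriv_V2)
    \<comment> \<open>The upper difference quotient at \<open>- x\<close>, with the subtracted
      positive value dropped.\<close>
    also have "\<dots> \<le> V1 (- x + 1)" using V1_deriv_squeeze(2)[of "- x"] pos[of "- x"] by simp
    also have "\<dots> = V2 (x - 1)" using V1_minus[of "x - 1"] by simp
    also have "\<dots> \<le> C * exp (- 6 * (x - 1))"
    proof (cases "x \<ge> 1")
      case True then show ?thesis using v2[of "x - 1"] by simp
    next
      case False
      have mono: "V1 y \<le> V1 z" if "y \<le> z" for y z
        by (rule DERIV_nonneg_imp_nondecreasing[OF that])
          (use V1_deriv profile[unfolded profile_def] in \<open>meson less_imp_le\<close>)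
      have "V2 (x - 1) = V1 (1 - x)" using V1_minus[of "x - 1"] by simp
      also have "\<dots> \<le> V1 1" using that by (intro mono) simp
      also have "\<dots> \<le> C * 1" using C1(1) C2(1) pos[of 0] by (simp add: C_def)
      also have "\<dots> \<le> C * exp (- 6 * (x - 1))" using False C0 by (intro mult_left_mono) auto
      finally show ?thesis .
    qed
    finally show ?thesis by (simp only: shift mult.assoc)
  qed
  \<comment> \<open>A sum of nonnegative terms that dominates the prefactor of each of the six
    estimates.\<close>
  define K where "K = 2 * C1 * exp 6 + D * exp 6 + C * exp 6 + C ^ 3 + 2 * C\<^sup>2"
  have terms: "0 \<le> 2 * C1 * exp 6" "0 \<le> D * exp 6" "0 \<le> C * exp 6" "0 \<le> C ^ 3" "0 \<le> C\<^sup>2"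
    using C1(1) C0 by (auto simp: D_def)
  have K0: "K \<ge> 0" using terms unfolding K_def by linarith
  have le: "t \<le> K * exp (- 4 * x)" if "t \<le> p * exp (- q * x)" "p \<le> K" "q \<ge> 4" "x \<ge> 0" "p \<ge> 0"
    for t p q x
  proof -
    have "4 * x \<le> q * x" using that by (intro mult_right_mono) auto
    then have "p * exp (- q * x) \<le> K * exp (- 4 * x)"
      using that K0 by (intro mult_mono) auto
    then show ?thesis using that by linarith
  qed
  have nn: "0 \<le> V1 x" "0 \<le> V2 x" for x using pos[of x] by auto
  show thesis
  proof (rule that)
    fix x :: real assume x: "x \<ge> 0"
    note b = v1[OF x] v2[OF x] nn[of x]
    have CE: "0 \<le> C * exp x" "0 \<le> C * exp (- 6 * x)" using C0 by auto
    show "\<bar>deriv V1 x - A\<bar> \<le> K * exp (- 4 * x)"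
      by (rule le[OF d1[OF x]]) (use terms x in \<open>auto simp: K_def\<close>)
    show "\<bar>deriv V2 x\<bar> \<le> K * exp (- 4 * x)"
      by (rule le[OF d2[OF x]]) (use terms x in \<open>auto simp: K_def\<close>)
    have "V1 x * (V2 x)\<^sup>2 \<le> (C * exp x) * (C * exp (- 6 * x))\<^sup>2"
      using b CE by (intro mult_mono power_mono) auto
    also have "\<dots> = C ^ 3 * exp (- 11 * x)"
      by (simp add: power2_eq_square power3_eq_cube mult_ac flip: exp_add)
    finally show "\<bar>V1 x * (V2 x)\<^sup>2\<bar> \<le> K * exp (- 4 * x)"
      using b by (simp only: abs_of_nonneg mult_nonneg_nonneg zero_le_power2)
        (rule le, assumption, use terms x C0 in \<open>auto simp: K_def\<close>)
    have "V2 x * (V1 x)\<^sup>2 \<le> (C * exp (- 6 * x)) * (C * exp x)\<^sup>2"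
      using b CE by (intro mult_mono power_mono) auto
    also have "\<dots> = C ^ 3 * exp (- 4 * x)"
      by (simp add: power2_eq_square power3_eq_cube mult_ac flip: exp_add)
    finally show "\<bar>V2 x * (V1 x)\<^sup>2\<bar> \<le> K * exp (- 4 * x)"
      using b by (simp only: abs_of_nonneg mult_nonneg_nonneg zero_le_power2)
        (rule le, assumption, use terms x C0 in \<open>auto simp: K_def\<close>)
    have "(V2 x)\<^sup>2 \<le> (C * exp (- 6 * x))\<^sup>2"
      using b CE by (intro power_mono) auto
    also have "\<dots> = C\<^sup>2 * exp (- 12 * x)"
      by (simp add: power2_eq_square mult_ac flip: exp_add)
    finally show "\<bar>(V2 x)\<^sup>2\<bar> \<le> K * exp (- 4 * x)"
      by (simp only: abs_of_nonneg zero_le_power2)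
        (rule le, assumption, use terms x C0 in \<open>auto simp: K_def\<close>)
    have "2 * V1 x * V2 x \<le> 2 * (C * exp x) * (C * exp (- 6 * x))"
      using b CE by (intro mult_mono) auto
    also have "\<dots> = 2 * C\<^sup>2 * exp (- 5 * x)"
      by (simp add: power2_eq_square mult_ac flip: exp_add)
    finally have "2 * V1 x * V2 x \<le> K * exp (- 4 * x)"
      by (rule le) (use terms x C0 in \<open>auto simp: K_def\<close>)
    then show "\<bar>2 * V1 x * V2 x\<bar> \<le> K * exp (- 4 * x)" using b by simp
  qed
qed

end

section \<open>The approximate kernel pair for a fixed R and its image under the operator\<close>

text \<open>For \<open>R \<ge> exp 1\<close> these bounds hold with \<omega> =
  \<open>R powr (- \<theta>)\<close>. \<open>1 / R \<le> \<omega>\<close> turns cutoff errors into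
  O(\<omega>) and gives \<open>\<omega> * R \<ge> 1\<close>; \<open>ln R \<ge> 1\<close> keeps the
  derivatives of the rescaled cutoff bounded.\<close>

locale approximate_kernel = profile_pair +
  fixes \<zeta> :: "real \<Rightarrow> real" and \<omega> R :: real
  assumes \<zeta>: "smooth_cutoff \<zeta>" and ln_R: "ln R \<ge> 1" and R: "R > 0"
    and \<omega>: "1 / R \<le> \<omega>" "\<omega> \<le> 1"
begin

text \<open>Without the absolute value of \<open>cutoff_at\<close>, the formula for the right
  half-line is smooth on the whole line, so the chain rule applies everywhere.\<close>

definition "h x = \<zeta> (x / ln R)"
definition "h1 x = deriv \<zeta> (x / ln R) / ln R"
definition "h2 x = deriv (deriv \<zeta>) (x / ln R) / (ln R)\<^sup>2"
definition "s x = sinh (\<omega> * (R - x)) / sinh (\<omega> * R)"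

text \<open>\<open>res1\<close> and \<open>res2\<close> are what survives of the two components of
  \<open>L_op\<close> at \<open>x > 0\<close>. The differentiated profile equations cancel the terms
  in \<open>deriv V1\<close> and \<open>deriv V2\<close> times \<open>h\<close>, apart from those
  with \<omega> squared, and \<open>A * s\<close> solves its own linear equation.\<close>

definition "res1 x = - 2 * (V1 x * (V2 x)\<^sup>2) * h1 x - (deriv V1 x - A) * h2 x
  + (V2 x)\<^sup>2 * A * (s x - h x) + \<omega>\<^sup>2 * (deriv V1 x - A) * h x"
definition "res2 x = - 2 * (V2 x * (V1 x)\<^sup>2) * h1 x - deriv V2 x * h2 x
  + (2 * V1 x * V2 x) * A * (s x - h x) + \<omega>\<^sup>2 * deriv V2 x * h x"

lemma cutoff_derivs:
  "(h has_real_derivative h1 x) (at x)" "(h1 has_real_derivative h2 x) (at x)"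
proof -
  have "ln R \<noteq> 0" using ln_R by linarith
  have "((\<lambda>x. \<zeta> (x / ln R)) has_real_derivative deriv \<zeta> (x / ln R) * (1 / ln R)) (at x)"
    by (rule DERIV_chain2[OF smooth_cutoff_deriv(1)[OF \<zeta>]])
      (use \<open>ln R \<noteq> 0\<close> in \<open>auto intro!: derivative_eq_intros simp del: ln_eq_zero_iff\<close>)
  then show "(h has_real_derivative h1 x) (at x)" by (simp add: h_def[abs_def] h1_def)
  have "((\<lambda>x. deriv \<zeta> (x / ln R)) has_real_derivative deriv (deriv \<zeta>) (x / ln R) * (1 / ln R)) (at x)"
    by (rule DERIV_chain2[OF smooth_cutoff_deriv(2)[OF \<zeta>]])
      (use \<open>ln R \<noteq> 0\<close> in \<open>auto intro!: derivative_eq_intros simp del: ln_eq_zero_iff\<close>)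
  from DERIV_cdivide[OF this, of "ln R"] show "(h1 has_real_derivative h2 x) (at x)"
    by (simp add: h1_def[abs_def] h2_def power2_eq_square)
qed

lemma sinh_derivs:
  "(s has_real_derivative - \<omega> * cosh (\<omega> * (R - x)) / sinh (\<omega> * R)) (at x)"
  "((\<lambda>x. - \<omega> * cosh (\<omega> * (R - x)) / sinh (\<omega> * R)) has_real_derivative \<omega>\<^sup>2 * s x) (at x)"
proof -
  have "\<omega> > 0" using \<omega> R by (smt (verit) divide_pos_pos)
  then have "\<omega> \<noteq> 0" "R \<noteq> 0" using R by auto
  then show "(s has_real_derivative - \<omega> * cosh (\<omega> * (R - x)) / sinh (\<omega> * R)) (at x)"
    "((\<lambda>x. - \<omega> * cosh (\<omega> * (R - x)) / sinh (\<omega> * R)) has_real_derivative \<omega>\<^sup>2 * s x) (at x)"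
    unfolding s_def[abs_def]
    by (auto intro!: derivative_eq_intros simp: power2_eq_square divide_simps)
qed

text \<open>The right-hand branches of \<open>phi\<close> continued to the whole line, with
  derivatives computed by hand. Second derivatives of the profile are replaced through its
  equations, so the coefficient of \<open>h\<close> in \<open>r1''\<close> is the third derivative
  of \<open>V1\<close>.\<close>

definition "r1 x = (deriv V1 x - A) * h x + A * s x"
definition "r1' x = V1 x * (V2 x)\<^sup>2 * h x + (deriv V1 x - A) * h1 x
  + A * (- \<omega> * cosh (\<omega> * (R - x)) / sinh (\<omega> * R))"
definition "r1'' x = (deriv V1 x * (V2 x)\<^sup>2 + 2 * V1 x * V2 x * deriv V2 x) * h x
  + 2 * (V1 x * (V2 x)\<^sup>2) * h1 x + (deriv V1 x - A) * h2 x + A * (\<omega>\<^sup>2 * s x)"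
definition "r2 x = deriv V2 x * h x"
definition "r2' x = V2 x * (V1 x)\<^sup>2 * h x + deriv V2 x * h1 x"
definition "r2'' x = (deriv V2 x * (V1 x)\<^sup>2 + 2 * V1 x * V2 x * deriv V1 x) * h x
  + 2 * (V2 x * (V1 x)\<^sup>2) * h1 x + deriv V2 x * h2 x"

lemma r_derivs:
  "(r1 has_real_derivative r1' x) (at x)" "(r1' has_real_derivative r1'' x) (at x)"
  "(r2 has_real_derivative r2' x) (at x)" "(r2' has_real_derivative r2'' x) (at x)"
  unfolding r1_def[abs_def] r1'_def[abs_def] r2_def[abs_def] r2'_def[abs_def] r1''_def r2''_def
  by (rule derivative_eq_intros V1_deriv V2_deriv V1_deriv2 V2_deriv2 cutoff_derivs sinh_derivs refl
      | simp add: algebra_simps power2_eq_square)+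

lemma phi_nonneg:
  assumes "x \<ge> 0"
  shows "fst (phi V1 V2 A \<zeta> \<omega> R) x = r1 x" "snd (phi V1 V2 A \<zeta> \<omega> R) x = r2 x"
  using assms
  by (simp_all add: phi_def right1_def right2_def r1_def r2_def h_def s_def cutoff_at_def)

lemma phi_neg:
  assumes "x < 0"
  shows "fst (phi V1 V2 A \<zeta> \<omega> R) x = - r2 (- x)" "snd (phi V1 V2 A \<zeta> \<omega> R) x = - r1 (- x)"
  using assms
  by (simp_all add: phi_def right1_def right2_def r1_def r2_def h_def s_def cutoff_at_def)

text \<open>The endpoint of the half-line stays schematic here and is set to 0 at each use.\<close>

lemmas phi1_pos =
  second_derivative_on_open[OF open_greaterThan _ _ r_derivs(1,2), where f = "fst (phi V1 V2 A \<zeta> \<omega> R)"]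
lemmas phi2_pos =
  second_derivative_on_open[OF open_greaterThan _ _ r_derivs(3,4), where f = "snd (phi V1 V2 A \<zeta> \<omega> R)"]
lemmas phi1_neg =
  second_derivative_on_open[OF open_lessThan _ _ odd_reflection_derivs[OF r_derivs(3,4)],
    where f = "fst (phi V1 V2 A \<zeta> \<omega> R)"]
lemmas phi2_neg =
  second_derivative_on_open[OF open_lessThan _ _ odd_reflection_derivs[OF r_derivs(1,2)],
    where f = "snd (phi V1 V2 A \<zeta> \<omega> R)"]

lemma phi_twice_differentiable:
  assumes "0 \<notin> S"
  shows "twice_differentiable_on (fst (phi V1 V2 A \<zeta> \<omega> R)) S"
    "twice_differentiable_on (snd (phi V1 V2 A \<zeta> \<omega> R)) S"
  unfolding twice_differentiable_on_def
proof safe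
  fix x assume "x \<in> S"
  then have "x \<noteq> 0" using assms by auto
  then consider "x > 0" | "x < 0" by linarith
  then show "fst (phi V1 V2 A \<zeta> \<omega> R) differentiable (at x)"
    "deriv (fst (phi V1 V2 A \<zeta> \<omega> R)) differentiable (at x)"
    "snd (phi V1 V2 A \<zeta> \<omega> R) differentiable (at x)"
    "deriv (snd (phi V1 V2 A \<zeta> \<omega> R)) differentiable (at x)"
    using phi1_pos(1,2)[of x 0] phi1_neg(1,2)[of x 0] phi2_pos(1,2)[of x 0] phi2_neg(1,2)[of x 0]
    by (cases; force simp: phi_nonneg phi_neg)+
qed

lemma L_op_pos:
  assumes "x > 0"
  shows "fst (L_op V1 V2 \<omega> (phi V1 V2 A \<zeta> \<omega> R)) x = res1 x"
    "snd (L_op V1 V2 \<omega> (phi V1 V2 A \<zeta> \<omega> R)) x = res2 x"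
proof -
  have "deriv (deriv (fst (phi V1 V2 A \<zeta> \<omega> R))) x = r1'' x"
    "deriv (deriv (snd (phi V1 V2 A \<zeta> \<omega> R))) x = r2'' x"
    using assms phi1_pos(3)[of x 0] phi2_pos(3)[of x 0] by (auto simp: phi_nonneg)
  then show "fst (L_op V1 V2 \<omega> (phi V1 V2 A \<zeta> \<omega> R)) x = res1 x"
    "snd (L_op V1 V2 \<omega> (phi V1 V2 A \<zeta> \<omega> R)) x = res2 x"
    using assms
    by (simp_all add: L_op_def phi_nonneg r1_def r1''_def res1_def r2_def r2''_def res2_def
        algebra_simps)
qed

text \<open>Reflection interchanges \<open>V1\<close> with \<open>V2\<close> and thereby the two
  rows of \<open>L_op\<close>; hence the residuals of the right half-line return swapped and
  negated.\<close>

lemma L_op_neg: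
  assumes "x < 0"
  shows "fst (L_op V1 V2 \<omega> (phi V1 V2 A \<zeta> \<omega> R)) x = - res2 (- x)"
    "snd (L_op V1 V2 \<omega> (phi V1 V2 A \<zeta> \<omega> R)) x = - res1 (- x)"
proof -
  have "deriv (deriv (fst (phi V1 V2 A \<zeta> \<omega> R))) x = - r2'' (- x)"
    "deriv (deriv (snd (phi V1 V2 A \<zeta> \<omega> R))) x = - r1'' (- x)"
    using assms phi1_neg(3)[of x 0] phi2_neg(3)[of x 0] by (auto simp: phi_neg)
  then show "fst (L_op V1 V2 \<omega> (phi V1 V2 A \<zeta> \<omega> R)) x = - res2 (- x)"
    "snd (L_op V1 V2 \<omega> (phi V1 V2 A \<zeta> \<omega> R)) x = - res1 (- x)"
    using assms
    by (simp_all add: L_op_def phi_neg r1_def r1''_def res1_def r2_def r2''_def res2_def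
        V1_minus V2_minus algebra_simps)
qed

section \<open>Bounds for the residual and for the distance to the profile derivatives\<close>

lemma s_bound: "0 \<le> x \<Longrightarrow> x \<le> R \<Longrightarrow> \<bar>s x - 1\<bar> \<le> 2 * \<omega> * x"
proof -
  have "\<omega> > 0" using \<omega> R by (smt (verit) divide_pos_pos)
  moreover have "1 \<le> \<omega> * R" using \<omega>(1) R by (simp add: field_simps)
  ultimately show "0 \<le> x \<Longrightarrow> x \<le> R \<Longrightarrow> \<bar>s x - 1\<bar> \<le> 2 * \<omega> * x"
    unfolding s_def by (rule sinh_ratio_bound)
qed

lemma h_near_zero:
  assumes "0 \<le> x" "x < ln R / 2"
  shows "h x = 1 \<and> h1 x = 0 \<and> h2 x = 0"
proof -
  have "\<bar>x / ln R\<bar> < 1 / 2" using assms ln_R by (simp add: field_simps)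
  from smooth_cutoff_near_zero[OF \<zeta> this] show ?thesis by (simp add: h_def h1_def h2_def)
qed

lemma res_bound:
  assumes M: "\<And>y. \<bar>\<zeta> y\<bar> \<le> M" "\<And>y. \<bar>deriv \<zeta> y\<bar> \<le> M" "\<And>y. \<bar>deriv (deriv \<zeta>) y\<bar> \<le> M"
    and K: "\<And>x. x \<ge> 0 \<Longrightarrow> \<bar>deriv V1 x - A\<bar> \<le> K * exp (- 4 * x)"
    "\<And>x. x \<ge> 0 \<Longrightarrow> \<bar>deriv V2 x\<bar> \<le> K * exp (- 4 * x)"
    "\<And>x. x \<ge> 0 \<Longrightarrow> \<bar>V1 x * (V2 x)\<^sup>2\<bar> \<le> K * exp (- 4 * x)"
    "\<And>x. x \<ge> 0 \<Longrightarrow> \<bar>V2 x * (V1 x)\<^sup>2\<bar> \<le> K * exp (- 4 * x)"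
    "\<And>x. x \<ge> 0 \<Longrightarrow> \<bar>(V2 x)\<^sup>2\<bar> \<le> K * exp (- 4 * x)"
    "\<And>x. x \<ge> 0 \<Longrightarrow> \<bar>2 * V1 x * V2 x\<bar> \<le> K * exp (- 4 * x)"
    and x: "0 \<le> x" "x \<le> R"
  shows "\<bar>res1 x\<bar> * exp x \<le> K * (4 * M + \<bar>A\<bar> * (M + 3)) * \<omega>"
    "\<bar>res2 x\<bar> * exp x \<le> K * (4 * M + \<bar>A\<bar> * (M + 3)) * \<omega>"
proof -
  \<comment> \<open>The chain-rule divisors are \<open>ln R\<close> and its square, both at least
    1.\<close>
  have div_le: "\<bar>t / u\<bar> \<le> M" if "\<bar>t\<bar> \<le> M" "u \<ge> 1" for t u
  proof -
    have "\<bar>t\<bar> / u \<le> \<bar>t\<bar> / 1" using that by (intro divide_left_mono) auto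
    then show ?thesis using that by simp
  qed
  have h: "\<bar>h x\<bar> \<le> M" "\<bar>h1 x\<bar> \<le> M" "\<bar>h2 x\<bar> \<le> M"
    unfolding h_def h1_def h2_def by (rule M div_le ln_R one_le_power)+
  note bound = residual_bound[OF x(1) R \<omega> _ _ _ h h_near_zero[OF x(1)] s_bound[OF x]]
  show "\<bar>res1 x\<bar> * exp x \<le> K * (4 * M + \<bar>A\<bar> * (M + 3)) * \<omega>"
    unfolding res1_def using K x by (intro bound) auto
  show "\<bar>res2 x\<bar> * exp x \<le> K * (4 * M + \<bar>A\<bar> * (M + 3)) * \<omega>"
    unfolding res2_def using K x by (intro bound) auto
qed

text \<open>Since \<theta> < 1, the weight is at most \<open>exp \<bar>x\<bar>\<close>, which the
  pointwise bounds allow for. The norm of a pair is at most the sum of its components, hence the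
  factor 2. The corner at 0 is excluded.\<close>

lemma weighted_norm_L_op_le:
  assumes \<theta>: "0 < \<theta>" "\<theta> < 1"
    and C: "\<And>x. 0 \<le> x \<Longrightarrow> x \<le> R \<Longrightarrow> \<bar>res1 x\<bar> * exp x \<le> C * \<omega>"
      "\<And>x. 0 \<le> x \<Longrightarrow> x \<le> R \<Longrightarrow> \<bar>res2 x\<bar> * exp x \<le> C * \<omega>"
  shows "weighted_norm \<theta> ({-R<..<R} - {0}) (L_op V1 V2 \<omega> (phi V1 V2 A \<zeta> \<omega> R)) \<le> ereal (2 * C * \<omega>)"
  unfolding weighted_norm_def
proof (intro SUP_least, unfold ereal_less_eq)
  fix x assume x: "x \<in> {-R<..<R} - {0}"
  let ?L = "L_op V1 V2 \<omega> (phi V1 V2 A \<zeta> \<omega> R)"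
  have "cosh (\<theta> * x) \<le> exp \<bar>\<theta> * x\<bar>"
  proof -
    have "exp (\<theta> * x) \<le> exp \<bar>\<theta> * x\<bar>" "exp (- (\<theta> * x)) \<le> exp \<bar>\<theta> * x\<bar>"
      by (simp_all only: exp_le_cancel_iff abs_ge_self abs_ge_minus_self)
    then show ?thesis by (simp add: cosh_def del: exp_le_cancel_iff)
  qed
  also have "\<dots> \<le> exp \<bar>x\<bar>" using \<theta> by (simp add: abs_mult mult_left_le_one_le)
  finally have cosh: "cosh (\<theta> * x) \<le> exp \<bar>x\<bar>" .
  have L: "\<bar>fst ?L x\<bar> * exp \<bar>x\<bar> \<le> C * \<omega>" "\<bar>snd ?L x\<bar> * exp \<bar>x\<bar> \<le> C * \<omega>"
    using x C[of "\<bar>x\<bar>"] by (cases "x > 0"; simp add: L_op_pos L_op_neg)+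
  have weight: "\<bar>t * cosh (\<theta> * x)\<bar> \<le> \<bar>t\<bar> * exp \<bar>x\<bar>" for t
    using mult_left_mono[OF cosh, of "\<bar>t\<bar>"] by (simp add: abs_mult)
  have "norm (fst ?L x * cosh (\<theta> * x), snd ?L x * cosh (\<theta> * x))
      \<le> \<bar>fst ?L x * cosh (\<theta> * x)\<bar> + \<bar>snd ?L x * cosh (\<theta> * x)\<bar>"
    using norm_Pair_le[of "fst ?L x * cosh (\<theta> * x)" "snd ?L x * cosh (\<theta> * x)"]
    by (simp only: real_norm_def)
  also have "\<dots> \<le> 2 * C * \<omega>"
    using L weight[of "fst ?L x"] weight[of "snd ?L x"] by linarith
  finally show "norm (fst ?L x * cosh (\<theta> * x), snd ?L x * cosh (\<theta> * x)) \<le> 2 * C * \<omega>" .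
qed

text \<open>Where the cutoff equals 1, one component coincides with the profile derivative and the
  other is off by \<open>A * (s \<bar>x\<bar> - 1)\<close> up to sign: the first for
  \<open>x \<ge> 0\<close>, the second for \<open>x < 0\<close>.\<close>

lemma phi_near_zero:
  assumes x: "\<bar>x\<bar> < ln R / 2"
  shows "dist (fst (phi V1 V2 A \<zeta> \<omega> R) x, snd (phi V1 V2 A \<zeta> \<omega> R) x) (deriv V1 x, deriv V2 x)
    \<le> \<bar>A\<bar> * (2 * \<omega> * \<bar>x\<bar>)"
proof -
  have "\<bar>x\<bar> \<le> R" using x R ln_le_minus_one[of R] by linarith
  then have s: "\<bar>A\<bar> * \<bar>s \<bar>x\<bar> - 1\<bar> \<le> \<bar>A\<bar> * (2 * \<omega> * \<bar>x\<bar>)"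
    using s_bound[of "\<bar>x\<bar>"] by (intro mult_left_mono) auto
  have h: "h \<bar>x\<bar> = 1" using h_near_zero[of "\<bar>x\<bar>"] x by auto
  have "\<bar>A\<bar> * \<bar>s \<bar>x\<bar> - 1\<bar> = \<bar>A * s \<bar>x\<bar> - A\<bar>" by (simp add: algebra_simps flip: abs_mult)
  then have "dist (fst (phi V1 V2 A \<zeta> \<omega> R) x, snd (phi V1 V2 A \<zeta> \<omega> R) x) (deriv V1 x, deriv V2 x)
    = \<bar>A\<bar> * \<bar>s \<bar>x\<bar> - 1\<bar>"
    using h deriv_V2[of x] deriv_V2[of "- x"]
    by (cases "x \<ge> 0")
      (auto simp: phi_nonneg phi_neg r1_def r2_def dist_Pair_Pair dist_real_def abs_minus_commute)
  then show ?thesis using s by simp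
qed

end

section \<open>Uniform bounds for large R and passage to the limit\<close>

theorem proposition2p1:
  fixes V1 V2 \<zeta> :: "real \<Rightarrow> real" and A \<theta> :: real
  assumes "profile V1 V2 A"
    and "0 < \<theta>" and "\<theta> < 1"
    and "smooth_cutoff \<zeta>"
  defines "\<omega> \<equiv> \<lambda>R. R powr (- \<theta>)"
  defines "\<phi> \<equiv> \<lambda>R. phi V1 V2 A \<zeta> (\<omega> R) R"
  shows "(\<forall>\<^sub>F R in at_top. twice_differentiable_on (fst (\<phi> R)) ({-R<..<R} - {0}) \<and>
                        twice_differentiable_on (snd (\<phi> R)) ({-R<..<R} - {0})) \<and>
         Limsup at_top (\<lambda>R. ereal (inverse (\<omega> R)) *
            weighted_norm \<theta> ({-R<..<R} - {0}) (L_op V1 V2 (\<omega> R) (\<phi> R))) < \<infinity> \<and>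
         (\<forall>K. compact K \<longrightarrow>
            uniform_limit K (\<lambda>R x. (fst (\<phi> R) x, snd (\<phi> R) x))
                            (\<lambda>x. (deriv V1 x, deriv V2 x)) at_top)"
proof -
  interpret profile_pair V1 V2 A by unfold_locales (rule assms)
  \<comment> \<open>The exponents satisfy -1 \<le> -\<theta> \<le> 0, so the power lies between
    \<open>1 / R\<close> and 1.\<close>
  have ker: "approximate_kernel V1 V2 A \<zeta> (\<omega> R) R" if "R \<ge> exp 1" for R
  proof unfold_locales
    have R1: "R \<ge> 1" using that exp_ge_add_one_self[of 1] by linarith
    show "smooth_cutoff \<zeta>" by (rule assms)
    show "R > 0" using R1 by simp
    then show "ln R \<ge> 1" using that by (simp add: ln_ge_iff)
    have "R powr - 1 \<le> R powr - \<theta>" using R1 assms(3) by (intro powr_mono) auto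
    then show "1 / R \<le> \<omega> R" using R1 by (simp add: \<omega>_def powr_minus_divide)
    have "R powr - \<theta> \<le> R powr 0" using R1 assms(2) by (intro powr_mono) auto
    then show "\<omega> R \<le> 1" using R1 by (simp add: \<omega>_def)
  qed
  have large: "\<forall>\<^sub>F R::real in at_top. R \<ge> exp 1" by (rule eventually_ge_at_top)
  obtain M where M: "\<And>y. \<bar>\<zeta> y\<bar> \<le> M" "\<And>y. \<bar>deriv \<zeta> y\<bar> \<le> M" "\<And>y. \<bar>deriv (deriv \<zeta>) y\<bar> \<le> M"
    by (rule smooth_cutoff_bounded[OF assms(4)]) blast
  obtain K where K: "\<And>x. x \<ge> 0 \<Longrightarrow> \<bar>deriv V1 x - A\<bar> \<le> K * exp (- 4 * x)"
    "\<And>x. x \<ge> 0 \<Longrightarrow> \<bar>deriv V2 x\<bar> \<le> K * exp (- 4 * x)"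
    "\<And>x. x \<ge> 0 \<Longrightarrow> \<bar>V1 x * (V2 x)\<^sup>2\<bar> \<le> K * exp (- 4 * x)"
    "\<And>x. x \<ge> 0 \<Longrightarrow> \<bar>V2 x * (V1 x)\<^sup>2\<bar> \<le> K * exp (- 4 * x)"
    "\<And>x. x \<ge> 0 \<Longrightarrow> \<bar>(V2 x)\<^sup>2\<bar> \<le> K * exp (- 4 * x)"
    "\<And>x. x \<ge> 0 \<Longrightarrow> \<bar>2 * V1 x * V2 x\<bar> \<le> K * exp (- 4 * x)"
    by (rule exponential_decay) blast
  \<comment> \<open>Built from \<open>K\<close>, \<open>M\<close> and \<open>A\<close> only, hence
    independent of \<open>R\<close>; this makes the limsup finite.\<close>
  define C where "C = K * (4 * M + \<bar>A\<bar> * (M + 3))"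
  have bound: "ereal (inverse (\<omega> R)) *
      weighted_norm \<theta> ({-R<..<R} - {0}) (L_op V1 V2 (\<omega> R) (\<phi> R)) \<le> ereal (2 * C)"
    if "R \<ge> exp 1" for R
  proof -
    interpret approximate_kernel V1 V2 A \<zeta> "\<omega> R" R by (rule ker[OF that])
    have pos: "\<omega> R > 0" using R by (simp add: \<omega>_def)
    have "weighted_norm \<theta> ({-R<..<R} - {0}) (L_op V1 V2 (\<omega> R) (\<phi> R)) \<le> ereal (2 * C * \<omega> R)"
      unfolding \<phi>_def
      by (rule weighted_norm_L_op_le[OF assms(2,3)]) (simp_all only: C_def res_bound[OF M K])
    then have "ereal (inverse (\<omega> R)) *
        weighted_norm \<theta> ({-R<..<R} - {0}) (L_op V1 V2 (\<omega> R) (\<phi> R))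
        \<le> ereal (inverse (\<omega> R)) * ereal (2 * C * \<omega> R)"
      using pos by (intro ereal_mult_left_mono) auto
    also have "\<dots> = ereal (2 * C)" using pos by simp
    finally show ?thesis .
  qed
  show ?thesis
  proof (intro conjI allI impI)
    show "\<forall>\<^sub>F R in at_top. twice_differentiable_on (fst (\<phi> R)) ({-R<..<R} - {0}) \<and>
        twice_differentiable_on (snd (\<phi> R)) ({-R<..<R} - {0})"
      using large unfolding \<phi>_def
      by eventually_elim (auto intro!: approximate_kernel.phi_twice_differentiable ker)
    have "Limsup at_top (\<lambda>R. ereal (inverse (\<omega> R)) *
        weighted_norm \<theta> ({-R<..<R} - {0}) (L_op V1 V2 (\<omega> R) (\<phi> R))) \<le> ereal (2 * C)"
      by (rule Limsup_bounded) (rule eventually_mono[OF large bound])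
    then show "Limsup at_top (\<lambda>R. ereal (inverse (\<omega> R)) *
        weighted_norm \<theta> ({-R<..<R} - {0}) (L_op V1 V2 (\<omega> R) (\<phi> R))) < \<infinity>"
      by (rule le_less_trans) simp
    fix S :: "real set" assume "compact S"
    then have "bounded S" by (rule compact_imp_bounded)
    then obtain m where m: "\<And>x. x \<in> S \<Longrightarrow> \<bar>x\<bar> \<le> m"
      unfolding bounded_iff by auto
    show "uniform_limit S (\<lambda>R x. (fst (\<phi> R) x, snd (\<phi> R) x)) (\<lambda>x. (deriv V1 x, deriv V2 x)) at_top"
    proof (rule uniform_limitI)
      fix e :: real assume e: "e > 0"
      have "(\<omega> \<longlongrightarrow> 0) at_top"
        unfolding \<omega>_def by (rule tendsto_neg_powr) (use assms(2) filterlim_ident in auto)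
      \<comment> \<open>The absolute value of \<open>m\<close> covers an empty \<open>S\<close>, for
        which \<open>m\<close> may be negative.\<close>
      then have "((\<lambda>R. \<bar>A\<bar> * (2 * \<omega> R * \<bar>m\<bar>)) \<longlongrightarrow> \<bar>A\<bar> * (2 * 0 * \<bar>m\<bar>)) at_top"
        by (intro tendsto_intros)
      then have "\<forall>\<^sub>F R in at_top. \<bar>A\<bar> * (2 * \<omega> R * \<bar>m\<bar>) < e"
        using e by (auto dest!: order_tendstoD(2)[where a = e])
      \<comment> \<open>From here on \<open>S\<close> lies inside the region where the cutoff equals
        1.\<close>
      moreover have "\<forall>\<^sub>F R::real in at_top. ln R > 2 * m"
        using ln_at_top by (simp add: filterlim_at_top_dense)
      ultimately show "\<forall>\<^sub>F R in at_top. \<forall>x\<in>S.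
          dist (fst (\<phi> R) x, snd (\<phi> R) x) (deriv V1 x, deriv V2 x) < e"
        using large
      proof eventually_elim
        case (elim R)
        interpret approximate_kernel V1 V2 A \<zeta> "\<omega> R" R by (rule ker[OF elim(3)])
        show ?case
        proof
          fix x assume x: "x \<in> S"
          then have "\<bar>x\<bar> < ln R / 2" using m[OF x] elim(2) by simp
          from phi_near_zero[OF this]
          have "dist (fst (\<phi> R) x, snd (\<phi> R) x) (deriv V1 x, deriv V2 x)
              \<le> \<bar>A\<bar> * (2 * \<omega> R * \<bar>x\<bar>)" by (simp add: \<phi>_def)
          also have "\<dots> \<le> \<bar>A\<bar> * (2 * \<omega> R * \<bar>m\<bar>)"
            using m[OF x] by (intro mult_left_mono) (auto simp: \<omega>_def)
          finally show "dist (fst (\<phi> R) x, snd (\<phi> R) x) (deriv V1 x, deriv V2 x) < e"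
            using elim(1) by linarith
        qed
      qed
    qed
  qed
qed

end
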